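(* Every $(2,2)$-tight finite simple graph with more than one vertex can be obtained from $K_4$ through a finite sequence of Henneberg moves and $(2,2)$-tight extension moves.
   Context: For a graph $H$ write $f(H)=2|V(H)|-|E(H)|$. A graph $G$ is $(2,2)$-sparse if $f(H)\ge 2$ for all subgraphs $H$ (with at least one vertex), and $(2,2)$-tight if moreover $f(G)=2$. $K_4$ is the complete graph on four vertices. Henneberg moves are the Henneberg 1 and Henneberg 2 moves. A Henneberg 1 move $G\to G'$ adds a new vertex of degree two joined by two new edges to two distinct vertices of $G$. A Henneberg 2 move $G\to G'$ removes an edge $v_iv_j$, adds a new vertex $w$ and the edges $v_iw,v_jw$, and adds an edge $wv_k$ to some other vertex $v_k$ of $G$ ($v_k\ne v_i,v_j$). For a subgraph $H$ of $G$, $G/H$ is the multigraph obtained by contracting $H$ to a single vertex $v_*$: its vertex set is $(V(G)\setminus V(H))\cup\{v_*\}$ and its edge set is $(E(G)\setminus E(H))\cup E_*$, with the edges $(v,w)$ of $G$ with $v\notin V(H)$, $w\in V(H)$ replaced by corresponding edges $(v,v_* )$ (forming $E_*$). A $(2,2)$-tight extension move $H\to G$ is an inclusion of a subgraph $H$ in a simple graph $G$ such that $G/H$ is a simple graph and $H$, $G$ and $G/H$ are all $(2,2)$-tight. *)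

theory Defs
  imports "HOL-Library.Multiset"
begin

text \<open>
  Finite multigraphs. An edge is represented by the set of its end points, and the edges form a
  multiset, so parallel edges are counted with multiplicity and a loop at \<open>v\<close> is \<open>{v}\<close>.
  Simple graphs are the multigraphs without loops and parallel edges.
\<close>

record 'v mgraph =
  verts :: "'v set"
  edges :: "'v set multiset"

definition multigraph :: "'v mgraph \<Rightarrow> bool" where
  "multigraph G \<longleftrightarrow> finite (verts G) \<and>
     (\<forall>e \<in># edges G. e \<subseteq> verts G \<and> (card e = 1 \<or> card e = 2))"

definition simple_graph :: "'v mgraph \<Rightarrow> bool" where
  "simple_graph G \<longleftrightarrow> multigraph G \<and> (\<forall>e \<in># edges G. card e = 2 \<and> count (edges G) e = 1)"

definition subgraph :: "'v mgraph \<Rightarrow> 'v mgraph \<Rightarrow> bool" where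
  "subgraph H G \<longleftrightarrow> multigraph H \<and> multigraph G \<and> verts H \<subseteq> verts G \<and> edges H \<subseteq># edges G"

definition freedom :: "'v mgraph \<Rightarrow> int" where
  "freedom G = 2 * int (card (verts G)) - int (size (edges G))"

definition sparse22 :: "'v mgraph \<Rightarrow> bool" where
  "sparse22 G \<longleftrightarrow> (\<forall>H. subgraph H G \<and> verts H \<noteq> {} \<longrightarrow> freedom H \<ge> 2)"

definition tight22 :: "'v mgraph \<Rightarrow> bool" where
  "tight22 G \<longleftrightarrow> sparse22 G \<and> freedom G = 2"

definition is_K4 :: "'v mgraph \<Rightarrow> bool" where
  "is_K4 G \<longleftrightarrow> card (verts G) = 4 \<and> edges G = mset_set {e. e \<subseteq> verts G \<and> card e = 2}"

text \<open>
  The contraction \<open>G/H\<close>: \<open>None\<close> is the new vertex \<open>v\<^sub>*\<close>, and \<open>Some v\<close> is a vertex \<open>v\<close> outside \<open>H\<close>.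
  Edges from such a \<open>v\<close> to distinct vertices of \<open>H\<close> become parallel edges, and an edge of \<open>G\<close>
  that joins two vertices of \<open>H\<close> without belonging to \<open>H\<close> becomes a loop at \<open>v\<^sub>*\<close>.
\<close>

definition contract_vertex :: "'v mgraph \<Rightarrow> 'v \<Rightarrow> 'v option" where
  "contract_vertex H v = (if v \<in> verts H then None else Some v)"

definition contract :: "'v mgraph \<Rightarrow> 'v mgraph \<Rightarrow> 'v option mgraph" where
  "contract G H =
     \<lparr> verts = insert None (Some ` (verts G - verts H)),
       edges = image_mset (image (contract_vertex H)) (edges G - edges H) \<rparr>"

definition henneberg1 :: "'v mgraph \<Rightarrow> 'v mgraph \<Rightarrow> bool" where
  "henneberg1 G G' \<longleftrightarrow> simple_graph G \<and>
     (\<exists>w a b. w \<notin> verts G \<and> a \<in> verts G \<and> b \<in> verts G \<and> a \<noteq> b \<and>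
        G' = \<lparr> verts = insert w (verts G), edges = edges G + {# {a, w}, {b, w} #} \<rparr>)"

definition henneberg2 :: "'v mgraph \<Rightarrow> 'v mgraph \<Rightarrow> bool" where
  "henneberg2 G G' \<longleftrightarrow> simple_graph G \<and>
     (\<exists>w a b c. w \<notin> verts G \<and> {a, b} \<in># edges G \<and> c \<in> verts G \<and> c \<noteq> a \<and> c \<noteq> b \<and>
        G' = \<lparr> verts = insert w (verts G),
               edges = edges G - {# {a, b} #} + {# {a, w}, {b, w}, {c, w} #} \<rparr>)"

definition tight_extension :: "'v mgraph \<Rightarrow> 'v mgraph \<Rightarrow> bool" where
  "tight_extension H G \<longleftrightarrow> subgraph H G \<and> simple_graph G \<and> simple_graph (contract G H) \<and>
     tight22 H \<and> tight22 G \<and> tight22 (contract G H)"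

definition construction_move :: "'v mgraph \<Rightarrow> 'v mgraph \<Rightarrow> bool" where
  "construction_move G G' \<longleftrightarrow> henneberg1 G G' \<or> henneberg2 G G' \<or> tight_extension G G'"

end

theory Submission
  imports Defs
begin

text \<open>
  The proof is by induction on the number of vertices: every simple (2,2)-tight graph \<open>G\<close> with at
  least two vertices is \<open>K\<^sub>4\<close>, or is the result of one construction move applied to a smaller graph
  of the same kind. For a vertex set \<open>X\<close> write \<open>i(X)\<close> for the number of edges of \<open>G\<close> inside \<open>X\<close>.
  Sparsity says \<open>i(X) \<le> 2|X| - 2\<close> for all nonempty \<open>X\<close>. Call \<open>X\<close> tight if it has at least two
  elements and equality holds; the induced graph \<open>G[X]\<close> is then (2,2)-tight as well.
  
  Suppose first that \<open>G\<close> has a proper tight set, and let \<open>X\<close> be a maximal one. If some vertex \<open>v\<close>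
  outside \<open>X\<close> has two neighbours in \<open>X\<close>, then the count for \<open>X \<union> {v}\<close> shows that it has exactly two
  and that \<open>X \<union> {v}\<close> is tight. By maximality this set is all of \<open>G\<close>, and \<open>G\<close> arises from \<open>G[X]\<close> by a
  Henneberg 1 move. Otherwise \<open>G/G[X]\<close> has no parallel edges, and it has no loops because \<open>G[X]\<close> is
  induced. Subtracting the equality for \<open>X\<close> from the inequalities for the sets containing \<open>X\<close> shows
  that the quotient is again tight, so \<open>G\<close> arises from \<open>G[X]\<close> by a tight extension
  (\<open>reduce_proper_tight_set\<close>).
  
  Suppose now that \<open>G\<close> has no proper tight set. Since \<open>G\<close> has \<open>2|V| - 2\<close> edges, the degrees add up
  to less than \<open>4|V|\<close>, so some vertex \<open>w\<close> has degree at most 3. Sparsity of \<open>G - w\<close> forces degree at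
  least 2, and degree 2 would make \<open>G - w\<close> a proper tight set. So \<open>w\<close> has exactly three neighbours.
  If two of them are not adjacent, then \<open>w\<close> can be removed and these two joined: the new edge
  keeps the graph sparse, since only a proper tight set would have no room for it. This undoes a
  Henneberg 2 move (\<open>henneberg2_remove\<close>). If all three are adjacent, then together with \<open>w\<close> they
  span a complete graph on four vertices, which is tight and therefore all of \<open>G\<close>.
\<close>

section \<open>Simple graphs as sets of edges\<close>

definition edges_in :: "'v set set \<Rightarrow> 'v set \<Rightarrow> 'v set set" where
  "edges_in E X = {e \<in> E. e \<subseteq> X}"

definition nbrs_in :: "'v set set \<Rightarrow> 'v set \<Rightarrow> 'v \<Rightarrow> 'v set" where
  "nbrs_in E X v = {x \<in> X. {v, x} \<in> E}"

text \<open>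
  Simplicity makes every multiplicity at most one, so a simple graph is the image under
  \<open>mset_set\<close> of a set of edges. Induced subgraphs then suffice to test sparsity, and the counting
  below takes place in sets.
\<close>

definition graph_of :: "'v set \<Rightarrow> 'v set set \<Rightarrow> 'v mgraph" where
  "graph_of V E = \<lparr>verts = V, edges = mset_set E\<rparr>"

lemma verts_graph_of [simp]: "verts (graph_of V E) = V"
  and edges_graph_of [simp]: "edges (graph_of V E) = mset_set E"
  by (simp_all add: graph_of_def)

locale simple_graph_on =
  fixes V :: "'v set" and E :: "'v set set"
  assumes finite_V: "finite V"
    and edge_subset: "e \<in> E \<Longrightarrow> e \<subseteq> V"
    and card_edge: "e \<in> E \<Longrightarrow> card e = 2"
begin

lemma finite_E: "finite E"
  by (rule finite_subset[of _ "Pow V"]) (use finite_V edge_subset in auto)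

lemma finite_edges_in: "finite (edges_in E X)"
  using finite_E by (simp add: edges_in_def)

lemma induced_graph: "X \<subseteq> V \<Longrightarrow> simple_graph_on X (edges_in E X)"
  using finite_V card_edge by unfold_locales (auto simp: edges_in_def intro: finite_subset)

lemma edges_in_V: "edges_in E V = E"
  using edge_subset by (auto simp: edges_in_def)

lemma simple_graph_of: "simple_graph (graph_of V E)"
  using finite_V finite_E edge_subset card_edge
  by (auto simp: simple_graph_def multigraph_def)

lemma multigraph_of: "multigraph (graph_of V E)"
  using simple_graph_of by (simp add: simple_graph_def)

lemma freedom_graph_of: "freedom (graph_of V E) = 2 * int (card V) - int (card E)"
  by (simp add: freedom_def)

lemma subgraph_induced: "X \<subseteq> V \<Longrightarrow> subgraph (graph_of X (edges_in E X)) (graph_of V E)"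
  using multigraph_of simple_graph_on.multigraph_of[OF induced_graph] finite_E
  by (auto simp: subgraph_def edges_in_def intro!: subset_imp_msubset_mset_set)

text \<open>
  An edge inside \<open>X \<union> {v}\<close> is either inside \<open>X\<close> or joins \<open>v\<close> to a neighbour in \<open>X\<close>. The equation
  between multisets serves the Henneberg moves, which are stated by adding edges to a multiset;
  its cardinality version serves the counting arguments.
\<close>

lemma edges_in_insert:
  assumes "X \<subseteq> V" and "v \<notin> X"
  shows "mset_set (edges_in E (insert v X)) =
    mset_set (edges_in E X) + image_mset (\<lambda>x. {x, v}) (mset_set (nbrs_in E X v))"
proof -
  have "edges_in E (insert v X) = edges_in E X \<union> (\<lambda>x. {x, v}) ` nbrs_in E X v"
  proof (intro equalityI subsetI)
    fix e assume e: "e \<in> edges_in E (insert v X)"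
    then obtain x y where xy: "e = {x, y}" "x \<noteq> y"
      using card_edge[of e] by (auto simp: edges_in_def card_2_iff)
    then show "e \<in> edges_in E X \<union> (\<lambda>x. {x, v}) ` nbrs_in E X v"
      using e by (auto simp: edges_in_def nbrs_in_def insert_commute)
  qed (auto simp: edges_in_def nbrs_in_def insert_commute)
  moreover have "finite (nbrs_in E X v)"
    using assms(1) finite_V finite_subset[of X V] by (auto simp: nbrs_in_def)
  moreover have "inj_on (\<lambda>x. {x, v}) (nbrs_in E X v)"
    by (auto simp: inj_on_def doubleton_eq_iff)
  moreover have "edges_in E X \<inter> (\<lambda>x. {x, v}) ` nbrs_in E X v = {}"
    using assms(2) by (auto simp: edges_in_def)
  ultimately show ?thesis
    by (simp add: mset_set_Union finite_edges_in image_mset_mset_set)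
qed

lemma card_edges_in_insert:
  assumes "X \<subseteq> V" and "v \<notin> X"
  shows "card (edges_in E (insert v X)) = card (edges_in E X) + card (nbrs_in E X v)"
  using arg_cong[OF edges_in_insert[OF assms], of size] by simp

lemma edges_remove_vertex:
  assumes "v \<in> V"
  shows "mset_set E = mset_set (edges_in E (V - {v})) +
    image_mset (\<lambda>x. {x, v}) (mset_set (nbrs_in E (V - {v}) v))"
  using edges_in_insert[of "V - {v}" v] assms edges_in_V by (simp add: insert_absorb)

lemma card_E_remove_vertex:
  assumes "v \<in> V"
  shows "card E = card (edges_in E (V - {v})) + card (nbrs_in E (V - {v}) v)"
  using card_edges_in_insert[of "V - {v}" v] assms edges_in_V by (simp add: insert_absorb)

lemma sum_degrees: "(\<Sum>v\<in>V. card (nbrs_in E (V - {v}) v)) = 2 * card E"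
proof -
  have deg: "card (nbrs_in E (V - {v}) v) = card {e \<in> E. v \<in> e}" if "v \<in> V" for v
  proof -
    have "E = edges_in E (V - {v}) \<union> {e \<in> E. v \<in> e}"
      using edge_subset by (auto simp: edges_in_def)
    moreover have "card (edges_in E (V - {v}) \<union> {e \<in> E. v \<in> e}) =
        card (edges_in E (V - {v})) + card {e \<in> E. v \<in> e}"
      by (rule card_Un_disjoint) (use finite_E in \<open>auto simp: edges_in_def\<close>)
    ultimately show ?thesis
      using card_E_remove_vertex[OF that] by simp
  qed
  have "card {v \<in> V. v \<in> e} = 2" if "e \<in> E" for e
  proof -
    have "{v \<in> V. v \<in> e} = e" using edge_subset[OF that] by auto
    then show ?thesis using card_edge[OF that] by simp
  qed
  then have "(\<Sum>v\<in>V. card {e \<in> E. v \<in> e}) = 2 * card E"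
    using sum_multicount[of V E "\<lambda>v e. v \<in> e" 2] finite_V finite_E by simp
  then show ?thesis using deg by simp
qed

text \<open>
  Among the subgraphs with a given vertex set the induced one has the most edges and hence the
  least freedom.
\<close>

lemma sparse22_graph_of_iff:
  "sparse22 (graph_of V E) \<longleftrightarrow>
    (\<forall>X. X \<subseteq> V \<longrightarrow> X \<noteq> {} \<longrightarrow> int (card (edges_in E X)) \<le> 2 * int (card X) - 2)"
proof (intro iffI allI impI)
  fix X assume sp: "sparse22 (graph_of V E)" and X: "X \<subseteq> V" "X \<noteq> {}"
  then show "int (card (edges_in E X)) \<le> 2 * int (card X) - 2"
    using subgraph_induced[OF X(1)] simple_graph_on.freedom_graph_of[OF induced_graph[OF X(1)]]
    unfolding sparse22_def by fastforce
next
  assume *: "\<forall>X. X \<subseteq> V \<longrightarrow> X \<noteq> {} \<longrightarrow> int (card (edges_in E X)) \<le> 2 * int (card X) - 2"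
  show "sparse22 (graph_of V E)"
    unfolding sparse22_def
  proof (intro allI impI)
    fix H assume H: "subgraph H (graph_of V E) \<and> verts H \<noteq> {}"
    have "edges H \<subseteq># mset_set (edges_in E (verts H))"
    proof (rule mset_subset_eqI)
      fix e
      have "count (edges H) e \<le> count (mset_set E) e"
        using H by (simp add: subgraph_def mset_subset_eq_count)
      moreover have "e \<subseteq> verts H" if "e \<in># edges H"
        using H that by (auto simp: subgraph_def multigraph_def)
      ultimately show "count (edges H) e \<le> count (mset_set (edges_in E (verts H))) e"
        using finite_E finite_edges_in
        by (cases "e \<in># edges H") (auto simp: edges_in_def count_mset_set' not_in_iff split: if_splits)
    qed
    then have "size (edges H) \<le> card (edges_in E (verts H))"
      using size_mset_mono by fastforce
    moreover have "int (card (edges_in E (verts H))) \<le> 2 * int (card (verts H)) - 2"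
      using * H by (simp add: subgraph_def)
    ultimately show "2 \<le> freedom H"
      by (simp add: freedom_def)
  qed
qed

end

lemma simple_graph_cases:
  assumes "simple_graph G"
  obtains E where "G = graph_of (verts G) E" and "simple_graph_on (verts G) E"
proof
  let ?E = "set_mset (edges G)"
  have "edges G = mset_set ?E"
  proof (rule multiset_eqI)
    fix e
    show "count (edges G) e = count (mset_set ?E) e"
      using assms by (cases "e \<in># edges G") (auto simp: simple_graph_def not_in_iff)
  qed
  then show "G = graph_of (verts G) ?E"
    by (simp add: graph_of_def)
  show "simple_graph_on (verts G) ?E"
    using assms by unfold_locales (auto simp: simple_graph_def multigraph_def)
qed

section \<open>Tight graphs and tight vertex sets\<close>

lemma henneberg1I:
  assumes "simple_graph G" and "w \<notin> verts G" and "a \<in> verts G" and "b \<in> verts G" and "a \<noteq> b"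
    and "G' = \<lparr>verts = insert w (verts G), edges = edges G + {#{a, w}, {b, w}#}\<rparr>"
  shows "henneberg1 G G'"
  using assms unfolding henneberg1_def by blast

lemma henneberg2I:
  assumes "simple_graph G" and "w \<notin> verts G" and "{a, b} \<in># edges G"
    and "c \<in> verts G" and "c \<noteq> a" and "c \<noteq> b"
    and "G' = \<lparr>verts = insert w (verts G),
               edges = edges G - {#{a, b}#} + {#{a, w}, {b, w}, {c, w}#}\<rparr>"
  shows "henneberg2 G G'"
  using assms unfolding henneberg2_def by blast

locale tight_graph = simple_graph_on V E for V :: "'v set" and E +
  assumes tight: "tight22 (graph_of V E)"
begin

lemma sparse: "X \<subseteq> V \<Longrightarrow> X \<noteq> {} \<Longrightarrow> int (card (edges_in E X)) \<le> 2 * int (card X) - 2"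
  using tight sparse22_graph_of_iff by (simp add: tight22_def)

lemma card_E: "int (card E) = 2 * int (card V) - 2"
  using tight freedom_graph_of by (simp add: tight22_def)

end

lemma (in simple_graph_on) tight_graphI:
  assumes "\<And>X. X \<subseteq> V \<Longrightarrow> X \<noteq> {} \<Longrightarrow> int (card (edges_in E X)) \<le> 2 * int (card X) - 2"
    and "int (card E) = 2 * int (card V) - 2"
  shows "tight_graph V E"
  using assms by unfold_locales (simp add: tight22_def sparse22_graph_of_iff freedom_graph_of)

context tight_graph
begin

text \<open>
  A single vertex also satisfies the equation, but it is excluded: starting from it would give
  every tight graph as an extension of a point, which says nothing about \<open>K\<^sub>4\<close>.
\<close>

definition tight_set :: "'v set \<Rightarrow> bool" where
  "tight_set X \<longleftrightarrow> X \<subseteq> V \<and> card X > 1 \<and> int (card (edges_in E X)) = 2 * int (card X) - 2"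

lemma tight_graph_induced:
  assumes "tight_set X"
  shows "tight_graph X (edges_in E X)"
proof -
  have X: "X \<subseteq> V" using assms by (simp add: tight_set_def)
  interpret H: simple_graph_on X "edges_in E X" by (rule induced_graph[OF X])
  show ?thesis
  proof (rule H.tight_graphI)
    fix Y assume Y: "Y \<subseteq> X" "Y \<noteq> {}"
    then have "edges_in (edges_in E X) Y = edges_in E Y" by (auto simp: edges_in_def)
    then show "int (card (edges_in (edges_in E X) Y)) \<le> 2 * int (card Y) - 2"
      using sparse[of Y] Y X by simp
  qed (use assms in \<open>simp add: tight_set_def\<close>)
qed

text \<open>
  Adding \<open>v\<close> raises the sparsity bound by exactly two, so two neighbours already reach it and
  three would exceed it.
\<close>

lemma tight_set_insert:
  assumes "tight_set X" and "v \<in> V - X" and "card (nbrs_in E X v) \<ge> 2"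
  shows "card (nbrs_in E X v) = 2" and "tight_set (insert v X)"
proof -
  have X: "X \<subseteq> V" "finite X"
    using assms(1) finite_V finite_subset by (auto simp: tight_set_def)
  have "int (card (edges_in E (insert v X))) \<le> 2 * int (card (insert v X)) - 2"
    using X assms(2) by (intro sparse) auto
  moreover have "card (edges_in E (insert v X)) = card (edges_in E X) + card (nbrs_in E X v)"
    using X assms(2) by (intro card_edges_in_insert) auto
  moreover have "card (insert v X) = Suc (card X)"
    using X assms(2) by simp
  ultimately show "card (nbrs_in E X v) = 2"
    and "tight_set (insert v X)"
    using assms X unfolding tight_set_def by simp_all
qed

section \<open>Undoing the construction moves\<close>

text \<open>
  Unless two edges join the same outside vertex to \<open>X\<close>, the edges of the quotient correspond
  one to one to the edges of \<open>G\<close> not inside \<open>X\<close>. The edges of the quotient inside a set \<open>Y\<close> can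
  then be counted in the preimage of \<open>Y\<close> in \<open>G\<close>. If \<open>Y\<close> contains the contracted vertex, the preimage
  is \<open>X \<union> Z\<close> with \<open>|Z| = |Y| - 1\<close>, and the count is
  \<open>i(X \<union> Z) - i(X) \<le> (2|X \<union> Z| - 2) - (2|X| - 2) = 2|Y| - 2\<close>.
\<close>

lemma tight_extension_if_single_nbrs:
  assumes "tight_set X" and single: "\<And>v. v \<in> V - X \<Longrightarrow> card (nbrs_in E X v) \<le> 1"
  shows "tight_extension (graph_of X (edges_in E X)) (graph_of V E)"
proof -
  define H where "H = graph_of X (edges_in E X)"
  define c where "c = contract_vertex H"
  define V' where "V' = insert None (Some ` (V - X))"
  define F where "F = E - edges_in E X"
  have X: "X \<subseteq> V" using assms by (simp add: tight_set_def)
  have finX: "finite X" using X finite_V finite_subset by blast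
  have c_in: "c v = None" if "v \<in> X" for v
    using that by (simp add: c_def H_def contract_vertex_def)
  have c_out: "c v = Some v" if "v \<notin> X" for v
    using that by (simp add: c_def H_def contract_vertex_def)
  have nbr_unique: "x = y" if "{v, x} \<in> E" "{v, y} \<in> E" "v \<notin> X" "x \<in> X" "y \<in> X" for v x y
  proof -
    have "v \<in> V - X" using that edge_subset by auto
    then have "card (nbrs_in E X v) \<le> Suc 0" using single by simp
    moreover have "finite (nbrs_in E X v)" using finX by (simp add: nbrs_in_def)
    ultimately show ?thesis using that by (auto simp: card_le_Suc0_iff_eq nbrs_in_def)
  qed
  \<comment> \<open>An edge that survives the contraction has an end point \<open>v\<close> outside \<open>X\<close>. Listing \<open>v\<close> first
      leaves only the position of the other end point open.\<close>
  have F_cases: "\<exists>v x. e = {v, x} \<and> v \<noteq> x \<and> v \<notin> X \<and> e \<in> E" if e: "e \<in> F" for e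
  proof -
    have eE: "e \<in> E" and ne: "\<not> e \<subseteq> X" using e by (auto simp: F_def edges_in_def)
    obtain p q where pq: "e = {p, q}" "p \<noteq> q" using card_edge[OF eE] by (auto simp: card_2_iff)
    show ?thesis
    proof (cases "p \<in> X")
      case True
      then have "e = {q, p} \<and> q \<noteq> p \<and> q \<notin> X \<and> e \<in> E" using pq ne eE by auto
      then show ?thesis by blast
    next
      case False
      then show ?thesis using pq eE by blast
    qed
  qed
  have inj: "inj_on ((`) c) F"
  proof (rule inj_onI)
    fix e f assume ef: "e \<in> F" "f \<in> F" "c ` e = c ` f"
    obtain v x where e: "e = {v, x}" "v \<noteq> x" "v \<notin> X" "e \<in> E" using F_cases ef(1) by blast
    obtain u y where f: "f = {u, y}" "u \<noteq> y" "u \<notin> X" "f \<in> E" using F_cases ef(2) by blast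
    have "{Some v, c x} = {Some u, c y}" using ef(3) e f c_out by simp
    then show "e = f"
      using e f nbr_unique[of v x y] c_in c_out
      by (cases "x \<in> X"; cases "y \<in> X") (auto simp: doubleton_eq_iff)
  qed
  have finF: "finite F" using finite_E by (simp add: F_def)
  have contract_eq: "contract (graph_of V E) H = graph_of V' ((`) c ` F)"
  proof -
    have "edges (graph_of V E) - edges H = mset_set F"
      using finite_E by (simp add: H_def F_def edges_in_def mset_set_Diff)
    then show ?thesis
      using inj by (simp add: contract_def c_def[symmetric] image_mset_mset_set)
        (simp add: graph_of_def V'_def H_def)
  qed
  interpret C: simple_graph_on V' "(`) c ` F"
  proof
    show "finite V'" using finite_V by (simp add: V'_def)
  next
    fix e' assume "e' \<in> (`) c ` F"
    then obtain v x where e: "e' = c ` {v, x}" "v \<noteq> x" "v \<notin> X" "{v, x} \<in> E" using F_cases by blast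
    then have "v \<in> V" "x \<in> V" using edge_subset by auto
    then show "e' \<subseteq> V'" using e c_in c_out by (cases "x \<in> X") (auto simp: V'_def)
    show "card e' = 2" using e c_in c_out by (cases "x \<in> X") auto
  qed
  have card_in: "card (edges_in ((`) c ` F) Y) = card (edges_in F {v. c v \<in> Y})" for Y
  proof -
    have "edges_in ((`) c ` F) Y = (`) c ` edges_in F {v. c v \<in> Y}"
      by (auto simp: edges_in_def)
    moreover have "inj_on ((`) c) (edges_in F {v. c v \<in> Y})"
      using inj by (rule inj_on_subset) (auto simp: edges_in_def)
    ultimately show ?thesis by (simp add: card_image)
  qed
  have cardEX: "int (card (edges_in E X)) = 2 * int (card X) - 2"
    using assms(1) by (simp add: tight_set_def)
  have tightC: "tight_graph V' ((`) c ` F)"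
  proof (rule C.tight_graphI)
    fix Y assume Y: "Y \<subseteq> V'" "Y \<noteq> {}"
    define Z where "Z = {v. Some v \<in> Y}"
    have Z: "Z \<subseteq> V - X" using Y by (auto simp: Z_def V'_def)
    have finZ: "finite Z" using Z finite_V finite_subset by blast
    show "int (card (edges_in ((`) c ` F) Y)) \<le> 2 * int (card Y) - 2"
    proof (cases "None \<in> Y")
      case True
      have Yeq: "Y = insert None (Some ` Z)"
        using Y True by (auto simp: Z_def V'_def)
      have "card Y = Suc (card Z)"
        by (simp add: Yeq finZ card_image)
      moreover have "{v. c v \<in> Y} = X \<union> Z"
      proof (intro set_eqI)
        fix v show "v \<in> {v. c v \<in> Y} \<longleftrightarrow> v \<in> X \<union> Z"
          using c_in c_out True by (cases "v \<in> X") (auto simp: Z_def)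
      qed
      moreover have "card (edges_in F (X \<union> Z)) = card (edges_in E (X \<union> Z)) - card (edges_in E X)"
      proof -
        have "edges_in F (X \<union> Z) = edges_in E (X \<union> Z) - edges_in E X"
          by (auto simp: F_def edges_in_def)
        moreover have "edges_in E X \<subseteq> edges_in E (X \<union> Z)" by (auto simp: edges_in_def)
        ultimately show ?thesis by (simp add: card_Diff_subset finite_edges_in)
      qed
      moreover have "card (edges_in E X) \<le> card (edges_in E (X \<union> Z))"
        by (rule card_mono[OF finite_edges_in]) (auto simp: edges_in_def)
      moreover have "int (card (edges_in E (X \<union> Z))) \<le> 2 * int (card (X \<union> Z)) - 2"
        using X Z assms(1) by (intro sparse) (auto simp: tight_set_def)
      moreover have "card (X \<union> Z) = card X + card Z"
        using Z finX finZ by (intro card_Un_disjoint) auto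
      ultimately show ?thesis
        using cardEX by (simp add: card_in of_nat_diff)
    next
      case False
      have Yeq: "Y = Some ` Z"
        using Y False by (auto simp: Z_def V'_def)
      have "card Y = card Z"
        by (simp add: Yeq finZ card_image)
      moreover have "{v. c v \<in> Y} = Z"
      proof (intro set_eqI)
        fix v show "v \<in> {v. c v \<in> Y} \<longleftrightarrow> v \<in> Z"
          using c_in c_out False Z by (cases "v \<in> X") (auto simp: Z_def)
      qed
      moreover have "card (edges_in F Z) \<le> card (edges_in E Z)"
        by (rule card_mono[OF finite_edges_in]) (auto simp: F_def edges_in_def)
      moreover have "int (card (edges_in E Z)) \<le> 2 * int (card Z) - 2"
        using Z Y Yeq by (intro sparse) auto
      ultimately show ?thesis by (simp add: card_in)
    qed
  next
    have "card ((`) c ` F) = card F" using inj by (rule card_image)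
    moreover have "card F = card E - card (edges_in E X)"
      unfolding F_def by (rule card_Diff_subset[OF finite_edges_in]) (auto simp: edges_in_def)
    moreover have "card (edges_in E X) \<le> card E"
      by (rule card_mono[OF finite_E]) (auto simp: edges_in_def)
    moreover have "card V' = Suc (card V - card X)"
      using finite_V X by (simp add: V'_def card_image card_Diff_subset finX)
    moreover have "card X \<le> card V" using X finite_V by (rule card_mono[rotated])
    ultimately show "int (card ((`) c ` F)) = 2 * int (card V') - 2"
      using card_E cardEX by (simp add: of_nat_diff)
  qed
  have "tight22 H" using tight_graph_induced[OF assms(1)] tight_graph.tight by (auto simp: H_def)
  moreover have "subgraph H (graph_of V E)" using subgraph_induced[OF X] by (simp add: H_def)
  ultimately show ?thesis
    using tight simple_graph_of C.simple_graph_of tight_graph.tight[OF tightC] contract_eq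
    by (simp add: tight_extension_def H_def)
qed

lemma henneberg1_remove:
  assumes w: "w \<in> V" and deg: "card (nbrs_in E (V - {w}) w) = 2"
  shows "henneberg1 (graph_of (V - {w}) (edges_in E (V - {w}))) (graph_of V E)"
proof -
  obtain a b where ab: "nbrs_in E (V - {w}) w = {a, b}" "a \<noteq> b"
    using deg by (auto simp: card_2_iff)
  then have abV: "a \<in> V - {w}" "b \<in> V - {w}"
    by (auto simp: nbrs_in_def)
  have "graph_of V E =
    \<lparr>verts = insert w (V - {w}), edges = mset_set (edges_in E (V - {w})) + {#{a, w}, {b, w}#}\<rparr>"
    using w ab edges_remove_vertex[OF w] by (simp add: graph_of_def insert_absorb)
  then show ?thesis
    using simple_graph_on.simple_graph_of[OF induced_graph[of "V - {w}"]] ab(2) abV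
    by (intro henneberg1I[of _ w a b]) auto
qed

text \<open>
  The edge \<open>ab\<close> raises \<open>i(X)\<close> by one for exactly those \<open>X\<close> that contain \<open>a\<close> and \<open>b\<close>. Such an \<open>X\<close>
  has at least two vertices and misses \<open>w\<close>. In the absence of proper tight sets it is not tight,
  so \<open>i(X)\<close> was at most \<open>2|X| - 3\<close>.
\<close>

lemma henneberg2_remove:
  assumes w: "w \<in> V" and nbrs: "nbrs_in E (V - {w}) w = {a, b, c}"
    and distinct: "a \<noteq> b" "c \<noteq> a" "c \<noteq> b" and nadj: "{a, b} \<notin> E"
    and no_tight: "\<And>X. tight_set X \<Longrightarrow> X = V"
  defines "E' \<equiv> insert {a, b} (edges_in E (V - {w}))"
  shows "tight_graph (V - {w}) E'"
    and "henneberg2 (graph_of (V - {w}) E') (graph_of V E)"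
proof -
  have abcV: "a \<in> V - {w}" "b \<in> V - {w}" "c \<in> V - {w}"
    using nbrs by (auto simp: nbrs_in_def set_eq_iff)
  have ab_new: "{a, b} \<notin> edges_in E (V - {w})" using nadj by (auto simp: edges_in_def)
  have deg: "card (nbrs_in E (V - {w}) w) = 3" using nbrs distinct by auto
  interpret R: simple_graph_on "V - {w}" E'
    using finite_V card_edge abcV distinct
    by unfold_locales (auto simp: E'_def edges_in_def)
  show "tight_graph (V - {w}) E'"
  proof (rule R.tight_graphI)
    fix X assume X: "X \<subseteq> V - {w}" "X \<noteq> {}"
    have finX: "finite X" using X finite_V finite_subset by blast
    have sp: "int (card (edges_in E X)) \<le> 2 * int (card X) - 2"
      using X by (intro sparse) auto
    show "int (card (edges_in E' X)) \<le> 2 * int (card X) - 2"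
    proof (cases "{a, b} \<subseteq> X")
      case True
      then have "edges_in E' X = insert {a, b} (edges_in E X)"
        using X by (auto simp: E'_def edges_in_def)
      then have "card (edges_in E' X) = Suc (card (edges_in E X))"
        using nadj finite_edges_in by (simp add: edges_in_def finite_E)
      moreover have "card X > 1"
        using card_mono[OF finX True] distinct by simp
      moreover have "X \<subseteq> V" using X by auto
      moreover have "\<not> tight_set X" using no_tight[of X] X w by auto
      ultimately show ?thesis
        using sp by (simp add: tight_set_def)
    next
      case False
      then have "edges_in E' X = edges_in E X"
        using X by (auto simp: E'_def edges_in_def)
      then show ?thesis using sp by simp
    qed
  next
    have "card E' = Suc (card (edges_in E (V - {w})))"
      using ab_new finite_edges_in by (simp add: E'_def)
    moreover have "card V = Suc (card (V - {w}))" by (rule card.remove[OF finite_V w])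
    ultimately show "int (card E') = 2 * int (card (V - {w})) - 2"
      using card_E card_E_remove_vertex[OF w] deg by linarith
  qed
  have "mset_set E' - {#{a, b}#} = mset_set (edges_in E (V - {w}))"
    unfolding E'_def mset_set.insert[OF finite_edges_in ab_new] by (rule add_mset_remove_trivial)
  moreover have "image_mset (\<lambda>x. {x, w}) (mset_set {a, b, c}) = {#{a, w}, {b, w}, {c, w}#}"
    using distinct by auto
  ultimately have "mset_set E = mset_set E' - {#{a, b}#} + {#{a, w}, {b, w}, {c, w}#}"
    using edges_remove_vertex[OF w] unfolding nbrs by argo
  then have "graph_of V E =
    \<lparr>verts = insert w (V - {w}),
     edges = mset_set E' - {#{a, b}#} + {#{a, w}, {b, w}, {c, w}#}\<rparr>"
    unfolding graph_of_def insert_Diff[OF w] by argo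
  moreover have "{a, b} \<in># mset_set E'" using R.finite_E by (simp add: E'_def)
  ultimately show "henneberg2 (graph_of (V - {w}) E') (graph_of V E)"
    using R.simple_graph_of distinct abcV
    by (intro henneberg2I[of _ w a b c]) auto
qed

section \<open>Every tight graph other than \<open>K\<^sub>4\<close> can be reduced\<close>

text \<open>
  Removing \<open>v\<close> lowers \<open>2|V| - 2\<close> by two, so a vertex of smaller degree would leave more edges than
  the sparsity of the remaining nonempty graph allows.
\<close>

lemma degree_ge_2:
  assumes "card V > 1" and "v \<in> V"
  shows "card (nbrs_in E (V - {v}) v) \<ge> 2"
proof -
  have cV: "card V = Suc (card (V - {v}))" by (rule card.remove[OF finite_V assms(2)])
  then have "V - {v} \<noteq> {}" using assms(1) by (metis One_nat_def card.empty less_irrefl)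
  then have "int (card (edges_in E (V - {v}))) \<le> 2 * int (card (V - {v})) - 2"
    by (intro sparse) auto
  then show ?thesis using card_E card_E_remove_vertex[OF assms(2)] cV by simp
qed

text \<open>
  The average degree is \<open>(4|V| - 4) / |V| < 4\<close>.
\<close>

lemma exists_degree_le_3:
  assumes "card V > 1"
  obtains v where "v \<in> V" and "card (nbrs_in E (V - {v}) v) \<le> 3"
proof (rule ccontr)
  assume "\<not> thesis"
  then have "\<And>v. v \<in> V \<Longrightarrow> 4 \<le> card (nbrs_in E (V - {v}) v)" using that by force
  then have "card V * 4 \<le> (\<Sum>v\<in>V. card (nbrs_in E (V - {v}) v))"
    using sum_mono[of V "\<lambda>_. 4" "\<lambda>v. card (nbrs_in E (V - {v}) v)"] by simp
  then show False using sum_degrees card_E assms by simp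
qed

text \<open>
  The count for \<open>V\<close> loses two on both sides, and the two neighbours of \<open>w\<close> remain.
\<close>

lemma remove_degree_2:
  assumes w: "w \<in> V" and deg: "card (nbrs_in E (V - {w}) w) = 2"
  shows "tight_set (V - {w})"
proof -
  have cV: "card V = Suc (card (V - {w}))" by (rule card.remove[OF finite_V w])
  have "card (nbrs_in E (V - {w}) w) \<le> card (V - {w})"
    using finite_V by (intro card_mono) (auto simp: nbrs_in_def)
  then show ?thesis
    using card_E card_E_remove_vertex[OF w] cV deg by (auto simp: tight_set_def)
qed

text \<open>
  A maximal proper tight set \<open>X\<close> leaves only two possibilities. A vertex with two neighbours in \<open>X\<close>
  could be added to \<open>X\<close>, so it is the only vertex outside and can be removed by undoing a
  Henneberg 1 move. If there is no such vertex, contracting \<open>X\<close> creates no parallel edges.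
\<close>

lemma reduce_proper_tight_set:
  assumes "tight_set X0" and "X0 \<noteq> V"
  obtains X where "tight_set X" and "X \<noteq> V"
    and "construction_move (graph_of X (edges_in E X)) (graph_of V E)"
proof -
  let ?S = "{X. tight_set X \<and> X \<noteq> V}"
  have "finite ?S"
    by (rule finite_subset[of _ "Pow V"]) (use finite_V in \<open>auto simp: tight_set_def\<close>)
  moreover have "?S \<noteq> {}" using assms by blast
  ultimately obtain X where X: "tight_set X" "X \<noteq> V"
    and max: "\<And>Y. tight_set Y \<Longrightarrow> Y \<noteq> V \<Longrightarrow> X \<subseteq> Y \<Longrightarrow> X = Y"
    using finite_has_maximal[of ?S] by auto
  have "construction_move (graph_of X (edges_in E X)) (graph_of V E)"
  proof (cases "\<exists>v \<in> V - X. card (nbrs_in E X v) \<ge> 2")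
    case True
    then obtain v where v: "v \<in> V - X" "card (nbrs_in E X v) \<ge> 2" by blast
    note t = tight_set_insert[OF X(1) v]
    have "insert v X = V" using t(2) max[of "insert v X"] v by blast
    then have "X = V - {v}" using v by auto
    moreover have "card (nbrs_in E X v) = 2" by (rule t(1))
    ultimately have "henneberg1 (graph_of X (edges_in E X)) (graph_of V E)"
      using henneberg1_remove[of v] v(1) by simp
    then show ?thesis by (simp add: construction_move_def)
  next
    case False
    then have "card (nbrs_in E X v) \<le> 1" if "v \<in> V - X" for v
      using that by force
    then have "tight_extension (graph_of X (edges_in E X)) (graph_of V E)"
      by (rule tight_extension_if_single_nbrs[OF X(1)])
    then show ?thesis by (simp add: construction_move_def)
  qed
  with X show ?thesis by (rule that)
qed

text \<open>
  Tightness gives \<open>2 \<cdot> 4 - 2 = 6\<close> edges, which is the number of all pairs of four vertices.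
\<close>

lemma is_K4_if_card_4:
  assumes "card V = 4"
  shows "is_K4 (graph_of V E)"
proof -
  have "E = {e. e \<subseteq> V \<and> card e = 2}"
  proof (rule card_subset_eq)
    show "finite {e. e \<subseteq> V \<and> card e = 2}" using finite_V by simp
    show "E \<subseteq> {e. e \<subseteq> V \<and> card e = 2}" using edge_subset card_edge by blast
    have "(4 choose 2) = (6 :: nat)" by (simp add: choose_two)
    then show "card E = card {e. e \<subseteq> V \<and> card e = 2}"
      using n_subsets[OF finite_V, of 2] card_E assms by simp
  qed
  then show ?thesis using assms by (simp add: is_K4_def)
qed

lemma is_K4_or_reduce:
  assumes "card V > 1"
  shows "is_K4 (graph_of V E) \<or>
    (\<exists>V' E'. tight_graph V' E' \<and> 1 < card V' \<and> card V' < card V \<and>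
       construction_move (graph_of V' E') (graph_of V E))"
proof (cases "\<exists>X. tight_set X \<and> X \<noteq> V")
  case True
  then obtain X where X: "tight_set X" "X \<noteq> V"
    "construction_move (graph_of X (edges_in E X)) (graph_of V E)"
    using reduce_proper_tight_set by blast
  moreover have "card X < card V"
    using X finite_V by (intro psubset_card_mono) (auto simp: tight_set_def)
  ultimately show ?thesis
    using tight_graph_induced[of X] by (auto simp: tight_set_def)
next
  case False
  then have no_tight: "X = V" if "tight_set X" for X using that by blast
  obtain w where w: "w \<in> V" "card (nbrs_in E (V - {w}) w) \<le> 3"
    using exists_degree_le_3 assms by blast
  moreover have "card (nbrs_in E (V - {w}) w) \<noteq> 2"
    using remove_degree_2[OF w(1)] no_tight[of "V - {w}"] w by auto
  ultimately have "card (nbrs_in E (V - {w}) w) = 3"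
    using degree_ge_2[OF assms w(1)] by simp
  then obtain a b c where nbrs: "nbrs_in E (V - {w}) w = {a, b, c}"
    and dist: "a \<noteq> b" "c \<noteq> a" "c \<noteq> b" by (auto simp: card_3_iff)
  have abcV: "a \<in> V - {w}" "b \<in> V - {w}" "c \<in> V - {w}"
    and abcE: "{a, w} \<in> E" "{b, w} \<in> E" "{c, w} \<in> E"
    using nbrs by (auto simp: nbrs_in_def insert_commute set_eq_iff)
  have cV: "card V = Suc (card (V - {w}))" by (rule card.remove[OF finite_V w(1)])
  have "card {a, b, c} \<le> card (V - {w})" using abcV finite_V by (intro card_mono) auto
  then have big: "1 < card (V - {w})" using dist by simp
  have reduce: ?thesis
    if "nbrs_in E (V - {w}) w = {p, q, r}" "p \<noteq> q" "r \<noteq> p" "r \<noteq> q" "{p, q} \<notin> E" for p q r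
  proof -
    let ?E' = "insert {p, q} (edges_in E (V - {w}))"
    have "tight_graph (V - {w}) ?E'" and "henneberg2 (graph_of (V - {w}) ?E') (graph_of V E)"
      using henneberg2_remove[OF w(1) that no_tight] by blast+
    moreover have "card (V - {w}) < card V" using cV by linarith
    ultimately show ?thesis using big unfolding construction_move_def by blast
  qed
  show ?thesis
  proof (cases "{a, b} \<in> E \<and> {b, c} \<in> E \<and> {a, c} \<in> E")
    case True
    let ?X = "{a, b, c, w}"
    have card_X: "card ?X = 4" using dist abcV by auto
    \<comment> \<open>All six pairs in this set are edges, which is the maximum \<open>2 \<cdot> 4 - 2\<close> that sparsity allows.\<close>
    have "{e. e \<subseteq> ?X \<and> card e = 2} \<subseteq> edges_in E ?X"
      using True abcE by (auto simp: edges_in_def card_2_iff insert_commute)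
    then have "card {e. e \<subseteq> ?X \<and> card e = 2} \<le> card (edges_in E ?X)"
      by (rule card_mono[OF finite_edges_in])
    moreover have "card {e. e \<subseteq> ?X \<and> card e = 2} = 6"
      using n_subsets[of ?X 2] card_X by (simp add: choose_two)
    moreover have "int (card (edges_in E ?X)) \<le> 2 * int (card ?X) - 2"
      using abcV w by (intro sparse) auto
    ultimately have "tight_set ?X" using abcV w card_X by (simp add: tight_set_def)
    then have "V = ?X" using no_tight by blast
    then show ?thesis using card_X is_K4_if_card_4 by argo
  next
    case False
    then consider "{a, b} \<notin> E" | "{b, c} \<notin> E" | "{a, c} \<notin> E" by blast
    then show ?thesis
    proof cases
      case 1
      then show ?thesis using nbrs dist by (intro reduce[of a b c]) auto
    next
      case 2
      then show ?thesis using nbrs dist by (intro reduce[of b c a]) auto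
    next
      case 3
      then show ?thesis using nbrs dist by (intro reduce[of a c b]) auto
    qed
  qed
qed

end

lemma tight_graph_construction:
  assumes "tight_graph V E" and "card V > 1"
  shows "\<exists>K. is_K4 K \<and> construction_move\<^sup>*\<^sup>* K (graph_of V E)"
  using assms
proof (induction "card V" arbitrary: V E rule: less_induct)
  case less
  show ?case
    using tight_graph.is_K4_or_reduce[OF less.prems]
  proof (elim disjE exE conjE)
    fix V' E'
    assume "tight_graph V' E'" "1 < card V'" "card V' < card V"
      and move: "construction_move (graph_of V' E') (graph_of V E)"
    then obtain K where "is_K4 K" "construction_move\<^sup>*\<^sup>* K (graph_of V' E')"
      using less.hyps by blast
    then show ?thesis using move by (meson rtranclp.rtrancl_into_rtrancl)
  qed blast
qed

theorem theorem2p11: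
  fixes G :: "'v mgraph"
  assumes "simple_graph G" and "tight22 G" and "card (verts G) > 1"
  shows "\<exists>K. is_K4 K \<and> construction_move\<^sup>*\<^sup>* K G"
proof -
  obtain E where G: "G = graph_of (verts G) E" and fin: "simple_graph_on (verts G) E"
    using assms(1) by (rule simple_graph_cases)
  have "tight_graph (verts G) E"
    using fin assms(2) G by (simp add: tight_graph_def tight_graph_axioms_def)
  then show ?thesis using tight_graph_construction assms(3) G by metis
qed

end
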